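(* Let $n$ be a positive integer, $I$ an index set, and $(A_i)_{i\in I}$ a family of pairwise commuting matrices in $M_n(\mathbb{C})$ such that the sum $\sum_{i\in I} A_i^* A_i$ converges. Then there is a family $(B_i)_{i\in I}$ of pairwise commuting normal matrices in $M_n(\mathbb{C})$ such that $$\sum_{i\in I}\|A_i-B_i\|_2^2\le n\cdot sw\Big(\sum_{i\in I}A_i^*A_i\Big).$$
   Context: $M_n(\mathbb{C})$ denotes the complex $n\times n$ matrices acting on $\mathbb{C}^n$ with its standard inner product $\langle\cdot\mid\cdot\rangle$ (linear in the second variable). For $A=(a_{jk})\in M_n(\mathbb{C})$, $\|A\|_2=\big(\sum_{j,k}|a_{jk}|^2\big)^{1/2}$ is the Hilbert–Schmidt (Frobenius) norm. The numerical range of an operator $A$ is $W(A)=\{\langle \xi\mid A\xi\rangle : \|\xi\|=1\}\subset\mathbb{C}$, and the numerical spread is $sw(A)=\operatorname{diam}W(A)=\sup_{z,z'\in W(A)}|z-z'|$. The sum over the (possibly infinite) index set is the limit of the net of finite partial sums. *)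

theory Defs
  imports "HOL-Analysis.Analysis"
begin

text \<open>Complex n x n matrices are rendered as complex^'n^'n with a finite index type 'n
  (so n = CARD('n) >= 1). Matrix product is (**), matrix-vector product is (*v).\<close>

definition adj :: "complex^'n^'n \<Rightarrow> complex^'n^'n" where
  "adj A = (\<chi> i j. cnj (A $ j $ i))"

definition normal_matrix :: "complex^'n^'n \<Rightarrow> bool" where
  "normal_matrix A \<longleftrightarrow> adj A ** A = A ** adj A"

text \<open>Hilbert-Schmidt (Frobenius) norm.\<close>
definition hs_norm :: "complex^'n^'n \<Rightarrow> real" where
  "hs_norm A = sqrt (\<Sum>j\<in>UNIV. \<Sum>k\<in>UNIV. (cmod (A $ j $ k))\<^sup>2)"

text \<open>Standard inner product on complex^'n, linear in the second variable.\<close>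
definition cinner :: "complex^'n \<Rightarrow> complex^'n \<Rightarrow> complex" where
  "cinner x y = (\<Sum>k\<in>UNIV. cnj (x $ k) * y $ k)"

definition vnorm :: "complex^'n \<Rightarrow> real" where
  "vnorm x = sqrt (\<Sum>k\<in>UNIV. (cmod (x $ k))\<^sup>2)"

text \<open>Numerical range.\<close>
definition num_range :: "complex^'n^'n \<Rightarrow> complex set" where
  "num_range A = {cinner \<xi> (A *v \<xi>) | \<xi>. vnorm \<xi> = 1}"

text \<open>Numerical spread: the diameter of the numerical range.\<close>
definition num_spread :: "complex^'n^'n \<Rightarrow> real" where
  "num_spread A = (SUP p\<in>num_range A \<times> num_range A. cmod (fst p - snd p))"

end

theory Submission
  imports Defs "HOL-Computational_Algebra.Fundamental_Theorem_Algebra"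
begin

text \<open>
  Commuting matrices have a common Schur basis: an orthonormal basis \<open>u\<^sub>1, \<dots>, u\<^sub>n\<close> in
  which every \<open>A\<^sub>i\<close> is upper triangular, with diagonal entries
  \<open>\<lambda>\<^sub>k(i) = \<langle>u\<^sub>k, A\<^sub>i u\<^sub>k\<rangle>\<close>. Take \<open>B\<^sub>i = \<Sum>\<^sub>k \<lambda>\<^sub>k(i) u\<^sub>k u\<^sub>k\<^sup>*\<close>; these are
  normal and commute. Then \<open>\<parallel>A\<^sub>i - B\<^sub>i\<parallel>\<^sub>2\<^sup>2 = \<Sum>\<^sub>k (\<parallel>A\<^sub>i u\<^sub>k\<parallel>\<^sup>2 - |\<lambda>\<^sub>k(i)|\<^sup>2)\<close>.
  The diagonal of a simultaneous triangular form consists of joint eigenvalues, so there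
  are unit vectors \<open>v\<^sub>k\<close> with \<open>A\<^sub>i v\<^sub>k = \<lambda>\<^sub>k(i) v\<^sub>k\<close> for all \<open>i\<close>, i.e.
  \<open>|\<lambda>\<^sub>k(i)|\<^sup>2 = \<parallel>A\<^sub>i v\<^sub>k\<parallel>\<^sup>2\<close>. Summing over \<open>i\<close> with \<open>T = \<Sum>\<^sub>i A\<^sub>i\<^sup>* A\<^sub>i\<close> gives
  \<open>\<Sum>\<^sub>i \<parallel>A\<^sub>i - B\<^sub>i\<parallel>\<^sub>2\<^sup>2 = \<Sum>\<^sub>k (\<langle>u\<^sub>k, T u\<^sub>k\<rangle> - \<langle>v\<^sub>k, T v\<^sub>k\<rangle>)\<close>, and each term is at most \<open>sw(T)\<close>.
\<close>

lemma cinner_add_right: "cinner x (y + z) = cinner x y + cinner x z"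
  by (simp add: cinner_def algebra_simps sum.distrib)

lemma cinner_diff_right: "cinner x (y - z) = cinner x y - cinner x z"
  by (simp add: cinner_def algebra_simps sum_subtractf)

lemma cinner_scale_right: "cinner x (c *s y) = c * cinner x y"
  by (simp add: cinner_def algebra_simps sum_distrib_left)

lemma cinner_zero_right [simp]: "cinner x 0 = 0"
  by (simp add: cinner_def)

lemma cinner_sum_right: "cinner x (\<Sum>k\<in>K. f k) = (\<Sum>k\<in>K. cinner x (f k))"
  by (induction K rule: infinite_finite_induct) (auto simp: cinner_add_right)

lemma cnj_cinner: "cnj (cinner x y) = cinner y x"
  by (simp add: cinner_def mult.commute)

lemma cinner_scale_left: "cinner (c *s x) y = cnj c * cinner x y"
  by (simp add: cinner_def algebra_simps sum_distrib_left)

lemma cinner_diff_left: "cinner (x - y) z = cinner x z - cinner y z"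
  by (simp add: cinner_def algebra_simps sum_subtractf)

lemma vnorm_eq_norm: "vnorm x = norm x"
  by (simp add: vnorm_def norm_vec_def L2_set_def)

lemma norm_sq_vec: "(norm (x :: complex^'n))\<^sup>2 = (\<Sum>k\<in>UNIV. (cmod (x $ k))\<^sup>2)"
  by (simp add: norm_vec_def L2_set_def sum_nonneg)

lemma cinner_self: "cinner x x = of_real ((norm x)\<^sup>2)"
  unfolding cinner_def norm_sq_vec of_real_sum complex_norm_square by (simp add: mult.commute)

lemma norm_smult_vec: "norm (c *s (x :: complex^'n)) = cmod c * norm x"
proof (rule power2_eq_imp_eq)
  have "(norm (c *s x))\<^sup>2 = (\<Sum>k\<in>UNIV. (cmod c)\<^sup>2 * (cmod (x $ k))\<^sup>2)"
    unfolding norm_sq_vec by (simp add: norm_mult power_mult_distrib)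
  also have "\<dots> = (cmod c * norm x)\<^sup>2"
    by (simp only: power_mult_distrib norm_sq_vec sum_distrib_left)
  finally show "(norm (c *s x))\<^sup>2 = (cmod c * norm x)\<^sup>2" .
qed simp_all

lemma norm_normalize_vec: "x \<noteq> 0 \<Longrightarrow> norm (of_real (inverse (norm x)) *s (x :: complex^'n)) = 1"
  by (simp add: norm_smult_vec norm_inverse)

lemma cinner_Cauchy_Schwarz: "cmod (cinner x y) \<le> norm x * norm y"
proof -
  have "cmod (cinner x y) \<le> (\<Sum>k\<in>UNIV. \<bar>cmod (x $ k)\<bar> * \<bar>cmod (y $ k)\<bar>)"
    unfolding cinner_def by (rule order_trans[OF norm_sum]) (simp add: norm_mult)
  also have "\<dots> \<le> norm x * norm y"
    unfolding norm_vec_def by (rule L2_set_mult_ineq)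
  finally show ?thesis .
qed

lemma cinner_adj_right: "cinner x (adj A *v y) = cinner (A *v x) y"
proof -
  have "cinner x (adj A *v y) = (\<Sum>k\<in>UNIV. \<Sum>l\<in>UNIV. cnj (x $ k) * cnj (A $ l $ k) * y $ l)"
    by (simp add: cinner_def adj_def matrix_vector_mult_def sum_distrib_left mult.assoc)
  also have "\<dots> = (\<Sum>l\<in>UNIV. \<Sum>k\<in>UNIV. cnj (x $ k) * cnj (A $ l $ k) * y $ l)"
    by (rule sum.swap)
  also have "\<dots> = cinner (A *v x) y"
    by (simp add: cinner_def matrix_vector_mult_def sum_distrib_left sum_distrib_right mult_ac)
  finally show ?thesis .
qed

lemma norm_mult_vec_sq: "(norm (A *v x))\<^sup>2 = Re (cinner x ((adj A ** A) *v x))"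
  by (simp add: matrix_vector_mul_assoc[symmetric] cinner_adj_right cinner_self)

lemma cinner_self_eq_1_iff: "cinner x x = 1 \<longleftrightarrow> norm x = 1"
proof -
  have "cinner x x = 1 \<longleftrightarrow> (norm x)\<^sup>2 = 1"
    unfolding cinner_self of_real_eq_1_iff ..
  then show ?thesis
    using norm_ge_zero[of x] by (auto simp: power2_eq_1_iff)
qed

abbreviation span_upto :: "(nat \<Rightarrow> complex^'n) \<Rightarrow> nat \<Rightarrow> (complex^'n) set" where
  "span_upto u m \<equiv> vec.span (u ` {..<m})"

definition orthonormal_upto :: "(nat \<Rightarrow> complex^'n) \<Rightarrow> nat \<Rightarrow> bool" where
  "orthonormal_upto u m \<longleftrightarrow> (\<forall>j<m. \<forall>k<m. cinner (u j) (u k) = (if j = k then 1 else 0))"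

lemma norm_orthonormal_upto: "orthonormal_upto u m \<Longrightarrow> k < m \<Longrightarrow> norm (u k) = 1"
  by (simp add: orthonormal_upto_def flip: cinner_self_eq_1_iff)

lemma span_upto_fun_upd: "k \<le> m \<Longrightarrow> span_upto (u(m := v)) k = span_upto u k"
  by (rule arg_cong[where f = vec.span]) (rule image_cong; simp)

lemma in_span_upto_Suc: "u m \<in> span_upto u (Suc m)"
  by (rule vec.span_base) simp

lemma span_upto_mono: "k \<le> m \<Longrightarrow> span_upto u k \<subseteq> span_upto u m"
  by (rule vec.span_mono) auto

lemma cinner_orthonormal_sum:
  assumes "orthonormal_upto u m" "j < m"
  shows "cinner (u j) (\<Sum>k<m. c k *s u k) = c j"
proof -
  have "cinner (u j) (\<Sum>k<m. c k *s u k) = (\<Sum>k<m. c k * cinner (u j) (u k))"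
    by (simp add: cinner_sum_right cinner_scale_right)
  also have "\<dots> = (\<Sum>k<m. if k = j then c j else 0)"
    by (rule sum.cong) (use assms in \<open>auto simp: orthonormal_upto_def\<close>)
  finally show ?thesis using assms(2) by simp
qed

lemma orthonormal_expansion:
  assumes u: "orthonormal_upto u m" and y: "y \<in> span_upto u m"
  shows "(\<Sum>k<m. cinner (u k) y *s u k) = y"
  using y
proof (induction rule: vec.span_induct)
  case base
  let ?P = "\<lambda>y. (\<Sum>k<m. cinner (u k) y *s u k) = y"
  show ?case
  proof (rule vec.subspaceI)
    fix x y assume "x \<in> Collect ?P" "y \<in> Collect ?P"
    then show "x + y \<in> Collect ?P"
      by (simp add: cinner_add_right vector_sadd_rdistrib sum.distrib)
  next
    fix c x assume "x \<in> Collect ?P"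
    then have "c *s (\<Sum>k<m. cinner (u k) x *s u k) = c *s x"
      by simp
    then show "c *s x \<in> Collect ?P"
      by (simp add: cinner_scale_right vec.scale_sum_right)
  qed simp
next
  case (step x)
  then obtain j where "j < m" "x = u j" by auto
  have "(\<Sum>k<m. cinner (u k) (u j) *s u k) = (\<Sum>k<m. if k = j then u j else 0)"
    by (rule sum.cong) (use u \<open>j < m\<close> in \<open>auto simp: orthonormal_upto_def\<close>)
  with \<open>j < m\<close> \<open>x = u j\<close> show ?case by simp
qed

lemma cinner_eq_0_on_span_upto:
  assumes "\<And>k. k < m \<Longrightarrow> cinner x (u k) = 0" and "y \<in> span_upto u m"
  shows "cinner x y = 0"
  using assms(2)
proof (induction rule: vec.span_induct)
  case base
  show ?case
    by (rule vec.subspaceI) (simp_all add: cinner_add_right cinner_scale_right)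
next
  case (step y)
  then show ?case using assms(1) by blast
qed

lemma span_upto_Suc_orthogonal:
  assumes u: "orthonormal_upto u (Suc m)" and z: "z \<in> span_upto u (Suc m)"
    and "cinner (u m) z = 0"
  shows "z \<in> span_upto u m"
proof -
  have "(\<Sum>k<m. cinner (u k) z *s u k) = z"
    using orthonormal_expansion[OF u z] assms(3) by simp
  moreover have "(\<Sum>k<m. cinner (u k) z *s u k) \<in> span_upto u m"
    by (intro vec.span_sum vec.span_scale vec.span_base) simp
  ultimately show ?thesis by simp
qed

lemma cinner_last_span_upto:
  assumes u: "orthonormal_upto u (Suc m)" and y: "y \<in> span_upto u m"
  shows "cinner (u m) y = 0"
proof (rule cinner_eq_0_on_span_upto[OF _ y])
  show "cinner (u m) (u k) = 0" if "k < m" for k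
    using u that by (simp add: orthonormal_upto_def)
qed

lemma last_notin_span_upto:
  assumes u: "orthonormal_upto u (Suc m)"
  shows "u m \<notin> span_upto u m"
proof
  assume "u m \<in> span_upto u m"
  then have "cinner (u m) (u m) = 0"
    by (rule cinner_last_span_upto[OF u])
  moreover have "cinner (u m) (u m) = 1"
    using u by (simp add: orthonormal_upto_def)
  ultimately show False by simp
qed

lemma parseval_span_upto:
  assumes u: "orthonormal_upto u m" and y: "y \<in> span_upto u m"
  shows "(\<Sum>k<m. (cmod (cinner (u k) y))\<^sup>2) = (norm y)\<^sup>2"
proof -
  have "of_real ((norm y)\<^sup>2) = cinner y (\<Sum>k<m. cinner (u k) y *s u k)"
    by (simp add: orthonormal_expansion[OF u y] cinner_self)
  also have "\<dots> = (\<Sum>k<m. cinner (u k) y * cnj (cinner (u k) y))"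
    by (simp add: cinner_sum_right cinner_scale_right cnj_cinner)
  also have "\<dots> = of_real (\<Sum>k<m. (cmod (cinner (u k) y))\<^sup>2)"
    unfolding of_real_sum complex_norm_square ..
  finally show ?thesis by (simp only: of_real_eq_iff)
qed

lemma card_le_CARD_if_independent:
  fixes S :: "('a::field^'n) set"
  assumes "vec.independent S"
  shows "card S \<le> CARD('n)"
proof -
  have "card S \<le> vec.dim S"
    using vec.independent_bound_general[OF assms] by simp
  also have "\<dots> \<le> vec.dim (UNIV :: ('a^'n) set)"
    by (rule vec.dim_subset) simp
  finally show ?thesis by (simp add: card_cart_basis)
qed

lemma orthonormal_upto_le_CARD:
  fixes u :: "nat \<Rightarrow> complex^'n"
  assumes u: "orthonormal_upto u m"
  shows "m \<le> CARD('n)"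
proof -
  have inj: "inj_on u {..<m}"
  proof (rule inj_onI, rule ccontr)
    fix j k assume jk: "j \<in> {..<m}" "k \<in> {..<m}" "j \<noteq> k" and eq: "u j = u k"
    have "cinner (u j) (u k) = 0" "cinner (u k) (u k) = 1"
      using u jk by (simp_all add: orthonormal_upto_def)
    with eq show False by simp
  qed
  have "vec.independent (u ` {..<m})"
  proof
    assume "vec.dependent (u ` {..<m})"
    then obtain c where c: "\<exists>v\<in>u ` {..<m}. c v \<noteq> 0" "(\<Sum>v\<in>u ` {..<m}. c v *s v) = 0"
      unfolding vec.dependent_finite[OF finite_imageI[OF finite_lessThan]] by blast
    then obtain j where j: "j < m" "c (u j) \<noteq> 0"
      by blast
    have "(\<Sum>k<m. c (u k) *s u k) = 0"
      using c(2) unfolding sum.reindex[OF inj] o_def .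
    then have "c (u j) = 0"
      using cinner_orthonormal_sum[OF u j(1), of "\<lambda>k. c (u k)"] by simp
    with j show False by simp
  qed
  from card_le_CARD_if_independent[OF this] show ?thesis
    by (simp add: card_image[OF inj])
qed

definition poly_mat_vec :: "complex poly \<Rightarrow> complex^'n^'n \<Rightarrow> complex^'n \<Rightarrow> complex^'n" where
  "poly_mat_vec p M x = (\<Sum>k\<le>degree p. coeff p k *s ((*v) M ^^ k) x)"

lemma poly_mat_vec_degree_le:
  assumes "degree p \<le> N"
  shows "poly_mat_vec p M x = (\<Sum>k\<le>N. coeff p k *s ((*v) M ^^ k) x)"
  unfolding poly_mat_vec_def
  by (rule sum.mono_neutral_left) (use assms in \<open>auto simp: coeff_eq_0\<close>)

lemma poly_mat_vec_add: "poly_mat_vec (p + q) M x = poly_mat_vec p M x + poly_mat_vec q M x"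
proof -
  define N where "N = max (degree p) (degree q)"
  have "degree (p + q) \<le> N" "degree p \<le> N" "degree q \<le> N"
    using degree_add_le_max[of p q] by (auto simp: N_def)
  then show ?thesis
    by (simp add: poly_mat_vec_degree_le[of _ N] vector_sadd_rdistrib sum.distrib)
qed

lemma poly_mat_vec_smult: "poly_mat_vec (smult c p) M x = c *s poly_mat_vec p M x"
  by (simp add: poly_mat_vec_degree_le[of _ "degree p"] vec.scale_sum_right)

lemma poly_mat_vec_pCons_0: "poly_mat_vec (pCons 0 q) M x = M *v poly_mat_vec q M x"
proof -
  have "poly_mat_vec (pCons 0 q) M x
      = (\<Sum>k\<le>Suc (degree q). coeff (pCons 0 q) k *s ((*v) M ^^ k) x)"
    by (rule poly_mat_vec_degree_le) simp
  also have "\<dots> = (\<Sum>k\<le>degree q. coeff q k *s (M *v ((*v) M ^^ k) x))"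
    by (simp only: sum.atMost_Suc_shift) simp
  also have "\<dots> = M *v poly_mat_vec q M x"
    by (simp add: poly_mat_vec_def vec.sum vec.scale)
  finally show ?thesis .
qed

lemma poly_mat_vec_linear_factor:
  "poly_mat_vec ([:-r, 1:] * q) M x = M *v poly_mat_vec q M x - r *s poly_mat_vec q M x"
proof -
  have "[:-r, 1:] * q = smult (-r) q + pCons 0 q"
    by (simp add: mult_pCons_left)
  then show ?thesis
    by (simp only: poly_mat_vec_add poly_mat_vec_smult poly_mat_vec_pCons_0 vector_smult_lneg)
      (simp add: algebra_simps)
qed

lemma poly_mat_vec_monom: "poly_mat_vec (monom c k) M x = c *s ((*v) M ^^ k) x"
proof -
  have "poly_mat_vec (monom c k) M x = (\<Sum>j\<le>k. coeff (monom c k) j *s ((*v) M ^^ j) x)"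
    by (rule poly_mat_vec_degree_le) (simp add: degree_monom_le)
  also have "\<dots> = c *s ((*v) M ^^ k) x"
    by (simp add: coeff_monom if_distrib[of "\<lambda>a. a *s _"] cong: if_cong)
  finally show ?thesis .
qed

lemma poly_mat_vec_in_subspace:
  assumes "vec.subspace V" "\<And>v. v \<in> V \<Longrightarrow> M *v v \<in> V" "x \<in> V"
  shows "poly_mat_vec p M x \<in> V"
proof -
  have "((*v) M ^^ k) x \<in> V" for k
    by (induction k) (use assms in auto)
  then show ?thesis
    unfolding poly_mat_vec_def by (intro vec.subspace_sum vec.subspace_scale assms(1))
qed

lemma exists_poly_mat_vec_eq_0:
  fixes M :: "complex^'n^'n"
  shows "\<exists>p. p \<noteq> 0 \<and> poly_mat_vec p M x = 0"
proof -
  define y where "y k = ((*v) M ^^ k) x" for k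
  show ?thesis
  proof (cases "inj_on y {..CARD('n)}")
    case False
    then obtain a b where ab: "a \<noteq> b" "y a = y b"
      unfolding inj_on_def by auto
    define p where "p = monom (1::complex) a + smult (-1) (monom 1 b)"
    have "coeff p a = 1"
      using ab by (simp add: p_def)
    moreover have "poly_mat_vec p M x = 0"
      using ab(2) unfolding p_def poly_mat_vec_add poly_mat_vec_smult poly_mat_vec_monom y_def
      by simp
    ultimately show ?thesis
      by (metis one_neq_zero coeff_0)
  next
    case True
    have "card (y ` {..CARD('n)}) = Suc CARD('n)"
      using card_image[OF True] by simp
    then have "vec.dependent (y ` {..CARD('n)})"
      using card_le_CARD_if_independent by fastforce
    then obtain c where c: "\<exists>v\<in>y ` {..CARD('n)}. c v \<noteq> 0" "(\<Sum>v\<in>y ` {..CARD('n)}. c v *s v) = 0"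
      unfolding vec.dependent_finite[OF finite_imageI[OF finite_atMost]] by blast
    define p where "p = (\<Sum>k\<le>CARD('n). monom (c (y k)) k)"
    have coeff_p: "coeff p j = (if j \<le> CARD('n) then c (y j) else 0)" for j
      by (simp add: p_def coeff_sum)
    from c(1) obtain k where "k \<le> CARD('n)" "c (y k) \<noteq> 0"
      by blast
    then have "p \<noteq> 0"
      by (metis coeff_0 coeff_p)
    moreover have "poly_mat_vec p M x = 0"
    proof -
      have "degree p \<le> CARD('n)"
        by (rule degree_le) (simp add: coeff_p)
      then have "poly_mat_vec p M x = (\<Sum>k\<le>CARD('n). c (y k) *s y k)"
        by (simp add: poly_mat_vec_degree_le coeff_p y_def)
      also have "\<dots> = 0"
        using c(2) unfolding sum.reindex[OF True] o_def .
      finally show ?thesis .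
    qed
    ultimately show ?thesis by blast
  qed
qed

text \<open>Peel linear factors off \<open>p\<close> until the image of \<open>x\<close> leaves \<open>U\<close>.\<close>

lemma eigenvector_mod_of_poly:
  assumes U: "vec.subspace U" and V: "vec.subspace V" "\<And>v. v \<in> V \<Longrightarrow> M *v v \<in> V"
    and x: "x \<in> V" "x \<notin> U"
  shows "p \<noteq> 0 \<Longrightarrow> poly_mat_vec p M x \<in> U \<Longrightarrow> \<exists>\<mu> w. w \<in> V \<and> w \<notin> U \<and> M *v w - \<mu> *s w \<in> U"
proof (induction "degree p" arbitrary: p rule: less_induct)
  case less
  show ?case
  proof (cases "degree p = 0")
    case True
    then obtain c where p: "p = [:c:]" and "c \<noteq> 0"
      using less.prems(1) by (metis degree_eq_zeroE pCons_0_0)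
    then have "c *s x \<in> U"
      using less.prems(2) by (simp add: poly_mat_vec_def)
    then have "inverse c *s (c *s x) \<in> U"
      by (rule vec.subspace_scale[OF U])
    with \<open>c \<noteq> 0\<close> x(2) show ?thesis by simp
  next
    case False
    then have "\<not> constant (poly p)"
      by (simp add: constant_degree)
    then obtain r where "poly p r = 0"
      using fundamental_theorem_of_algebra by blast
    then obtain q where pq: "p = [:-r, 1:] * q"
      by (metis dvdE poly_eq_0_iff_dvd)
    with less.prems(1) have "q \<noteq> 0" by auto
    then have "degree q < degree p"
      unfolding pq by (subst degree_mult_eq) auto
    show ?thesis
    proof (cases "poly_mat_vec q M x \<in> U")
      case True
      with less.hyps \<open>degree q < degree p\<close> \<open>q \<noteq> 0\<close> show ?thesis by blast
    next
      case False
      moreover have "poly_mat_vec q M x \<in> V"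
        using poly_mat_vec_in_subspace V x(1) by blast
      moreover have "M *v poly_mat_vec q M x - r *s poly_mat_vec q M x \<in> U"
        using less.prems(2) unfolding pq poly_mat_vec_linear_factor .
      ultimately show ?thesis by blast
    qed
  qed
qed

lemma eigenvector_mod:
  fixes M :: "complex^'n^'n"
  assumes "vec.subspace U" "vec.subspace V" "U \<subset> V" "\<And>v. v \<in> V \<Longrightarrow> M *v v \<in> V"
  shows "\<exists>\<mu> w. w \<in> V \<and> w \<notin> U \<and> M *v w - \<mu> *s w \<in> U"
proof -
  obtain x where x: "x \<in> V" "x \<notin> U"
    using assms(3) by blast
  obtain p where "p \<noteq> 0" "poly_mat_vec p M x = 0"
    using exists_poly_mat_vec_eq_0 by blast
  then show ?thesis
    using eigenvector_mod_of_poly[OF assms(1,2,4) x] vec.subspace_0[OF assms(1)] by simp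
qed

lemma subspace_eigenspace_mod:
  assumes "vec.subspace U" "vec.subspace V"
  shows "vec.subspace {v \<in> V. M *v v - \<mu> *s v \<in> U}"
proof (rule vec.subspaceI)
  fix x y assume x: "x \<in> {v \<in> V. M *v v - \<mu> *s v \<in> U}" and y: "y \<in> {v \<in> V. M *v v - \<mu> *s v \<in> U}"
  have eq: "M *v (x + y) - \<mu> *s (x + y) = (M *v x - \<mu> *s x) + (M *v y - \<mu> *s y)"
    by (simp add: matrix_vector_right_distrib vector_add_ldistrib algebra_simps)
  have "(M *v x - \<mu> *s x) + (M *v y - \<mu> *s y) \<in> U" "x + y \<in> V"
    using x y assms by (simp_all add: vec.subspace_add)
  then show "x + y \<in> {v \<in> V. M *v v - \<mu> *s v \<in> U}"
    unfolding mem_Collect_eq eq by blast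
next
  fix c x assume x: "x \<in> {v \<in> V. M *v v - \<mu> *s v \<in> U}"
  have eq: "M *v (c *s x) - \<mu> *s (c *s x) = c *s (M *v x - \<mu> *s x)"
    by (simp add: vector_scalar_commute vector_ssub_ldistrib mult.commute)
  have "c *s (M *v x - \<mu> *s x) \<in> U" "c *s x \<in> V"
    using x vec.subspace_scale[OF assms(1)] vec.subspace_scale[OF assms(2)] by blast+
  then show "c *s x \<in> {v \<in> V. M *v v - \<mu> *s v \<in> U}"
    unfolding mem_Collect_eq eq by blast
qed (use assms in \<open>simp add: vec.subspace_0\<close>)

lemma commuting_preserves_eigenspace_mod:
  fixes B M :: "'a::field^'n^'n"
  assumes "B ** M = M ** B" "v \<in> V" "M *v v - \<mu> *s v \<in> U"
    and "\<And>v. v \<in> V \<Longrightarrow> B *v v \<in> V" "\<And>v. v \<in> U \<Longrightarrow> B *v v \<in> U"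
  shows "B *v v \<in> {v \<in> V. M *v v - \<mu> *s v \<in> U}"
proof -
  have "M *v (B *v v) - \<mu> *s (B *v v) = B *v (M *v v - \<mu> *s v)"
    by (simp add: matrix_vector_mult_diff_distrib vector_scalar_commute matrix_vector_mul_assoc
        assms(1))
  then show ?thesis
    using assms by simp
qed

text \<open>
  Induction on \<open>dim V\<close>: if some \<open>A i\<close> is not a scalar on \<open>V\<close> modulo \<open>U\<close>, replace \<open>V\<close> by
  an eigenspace of \<open>A i\<close> modulo \<open>U\<close>, which is smaller and, by commutativity, still invariant.
\<close>

lemma common_eigenvector_mod:
  fixes A :: "'i \<Rightarrow> complex^'n^'n"
  assumes comm: "\<forall>i\<in>I. \<forall>j\<in>I. A i ** A j = A j ** A i"
    and U: "vec.subspace U" "\<forall>i\<in>I. \<forall>v\<in>U. A i *v v \<in> U"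
  shows "vec.subspace V \<Longrightarrow> U \<subset> V \<Longrightarrow> \<forall>i\<in>I. \<forall>v\<in>V. A i *v v \<in> V
    \<Longrightarrow> \<exists>w. w \<in> V \<and> w \<notin> U \<and> (\<forall>i\<in>I. \<exists>\<mu>. A i *v w - \<mu> *s w \<in> U)"
proof (induction "vec.dim V" arbitrary: V rule: less_induct)
  case less
  show ?case
  proof (cases "\<forall>i\<in>I. \<exists>\<mu>. \<forall>v\<in>V. A i *v v - \<mu> *s v \<in> U")
    case True
    obtain w where "w \<in> V" "w \<notin> U"
      using less.prems(2) by blast
    with True show ?thesis by blast
  next
    case False
    then obtain i0 where i0: "i0 \<in> I" and not_eigen: "\<And>\<mu>. \<exists>v\<in>V. A i0 *v v - \<mu> *s v \<notin> U"
      by blast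
    obtain \<mu> w0 where w0: "w0 \<in> V" "w0 \<notin> U" "A i0 *v w0 - \<mu> *s w0 \<in> U"
      using eigenvector_mod[OF U(1) less.prems(1,2)] less.prems(3) i0 by blast
    define V' where "V' = {v \<in> V. A i0 *v v - \<mu> *s v \<in> U}"
    have "vec.subspace V'"
      unfolding V'_def by (rule subspace_eigenspace_mod[OF U(1) less.prems(1)])
    moreover have "U \<subset> V'"
      using less.prems(2) U i0 w0 by (auto simp: V'_def vec.subspace_diff vec.subspace_scale)
    moreover have "\<forall>i\<in>I. \<forall>v\<in>V'. A i *v v \<in> V'"
      using commuting_preserves_eigenspace_mod[of "A _" "A i0"] comm i0 less.prems(3) U(2)
      by (auto simp: V'_def)
    moreover have "vec.dim V' < vec.dim V"
    proof (rule vec.dim_psubset)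
      have "V' \<subset> V"
        using not_eigen[of \<mu>] by (auto simp: V'_def)
      then show "vec.span V' \<subset> vec.span V"
        unfolding vec.span_eq_iff[THEN iffD2, OF \<open>vec.subspace V'\<close>]
          vec.span_eq_iff[THEN iffD2, OF less.prems(1)] .
    qed
    ultimately show ?thesis
      using less.hyps[of V'] by (auto simp: V'_def)
  qed
qed

definition schur_basis ::
    "('i \<Rightarrow> complex^'n^'n) \<Rightarrow> 'i set \<Rightarrow> (nat \<Rightarrow> complex^'n) \<Rightarrow> nat \<Rightarrow> bool" where
  "schur_basis A I u m \<longleftrightarrow> orthonormal_upto u m \<and>
     (\<forall>k<m. \<forall>i\<in>I. A i *v u k - cinner (u k) (A i *v u k) *s u k \<in> span_upto u k)"

lemma schur_basis_mono: "schur_basis A I u m \<Longrightarrow> k \<le> m \<Longrightarrow> schur_basis A I u k"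
  by (auto simp: schur_basis_def orthonormal_upto_def)

lemma schur_basis_invariant:
  assumes u: "schur_basis A I u m" and "i \<in> I" "k \<le> m" and y: "y \<in> span_upto u k"
  shows "A i *v y \<in> span_upto u k"
  using y
proof (induction rule: vec.span_induct)
  case base
  show ?case
    using vec.subspace_vimage[OF vec.subspace_span] by (simp add: vimage_def)
next
  case (step x)
  then obtain j where j: "j < k" "x = u j" by auto
  define d where "d = cinner (u j) (A i *v u j)"
  have "A i *v u j - d *s u j \<in> span_upto u k"
    using u assms(2,3) j span_upto_mono[of j k u] by (auto simp: schur_basis_def d_def)
  moreover have "d *s u j \<in> span_upto u k"
    using j by (intro vec.span_scale vec.span_base) auto
  ultimately show ?case
    using j(2) vec.span_add by fastforce
qed

lemma gram_schmidt_step: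
  assumes u: "orthonormal_upto u m" and w: "w \<notin> span_upto u m"
  shows "\<exists>v a. orthonormal_upto (u(m := v)) (Suc m) \<and> a *s w - v \<in> span_upto u m"
proof -
  define p where "p = (\<Sum>k<m. cinner (u k) w *s u k)"
  define a where "a = complex_of_real (inverse (norm (w - p)))"
  define v where "v = a *s (w - p)"
  have p: "p \<in> span_upto u m"
    unfolding p_def by (intro vec.span_sum vec.span_scale vec.span_base) auto
  with w have "w - p \<noteq> 0" by auto
  then have "norm v = 1"
    unfolding v_def a_def by (rule norm_normalize_vec)
  then have vv: "cinner v v = 1"
    by (simp add: cinner_self_eq_1_iff)
  have perp: "cinner (u j) v = 0" if "j < m" for j
    using cinner_orthonormal_sum[OF u that, of "\<lambda>k. cinner (u k) w"]
    by (simp add: v_def p_def cinner_scale_right cinner_diff_right)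
  then have "cinner v (u j) = 0" if "j < m" for j
    using that by (metis cnj_cinner complex_cnj_zero)
  with u vv perp have "orthonormal_upto (u(m := v)) (Suc m)"
    by (auto simp: orthonormal_upto_def less_Suc_eq)
  moreover have "a *s w - v \<in> span_upto u m"
    using p by (simp add: v_def vector_ssub_ldistrib vec.span_scale)
  ultimately show ?thesis by blast
qed

lemma schur_basis_Suc:
  assumes u: "schur_basis A I u m" and v: "orthonormal_upto (u(m := v)) (Suc m)"
    and v_eigen: "\<And>i. i \<in> I \<Longrightarrow> A i *v v - \<mu> i *s v \<in> span_upto u m"
  shows "schur_basis A I (u(m := v)) (Suc m)"
proof -
  have span: "span_upto (u(m := v)) k = span_upto u k" if "k \<le> m" for k
    using that by (rule span_upto_fun_upd)
  have diag: "cinner v (A i *v v) = \<mu> i" if "i \<in> I" for i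
  proof -
    have "cinner v (A i *v v - \<mu> i *s v) = 0"
      using cinner_last_span_upto[OF v] v_eigen[OF that] span[of m] by simp
    moreover have "cinner v v = 1"
      using norm_orthonormal_upto[OF v, of m] by (simp add: cinner_self_eq_1_iff)
    ultimately show ?thesis
      by (simp add: cinner_diff_right cinner_scale_right)
  qed
  show ?thesis
    unfolding schur_basis_def
  proof (intro conjI v allI impI ballI)
    fix k i assume "k < Suc m" "i \<in> I"
    then consider "k < m" | "k = m" by linarith
    then show "A i *v (u(m := v)) k - cinner ((u(m := v)) k) (A i *v (u(m := v)) k) *s (u(m := v)) k
        \<in> span_upto (u(m := v)) k"
    proof cases
      case 1
      then show ?thesis
        using u \<open>i \<in> I\<close> span[of k] by (simp add: schur_basis_def)
    next
      case 2
      then show ?thesis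
        using v_eigen[OF \<open>i \<in> I\<close>] diag[OF \<open>i \<in> I\<close>] span[of m] by simp
    qed
  qed
qed

lemma schur_basis_extend:
  fixes A :: "'i \<Rightarrow> complex^'n^'n"
  assumes comm: "\<forall>i\<in>I. \<forall>j\<in>I. A i ** A j = A j ** A i"
    and u: "schur_basis A I u m" and not_full: "span_upto u m \<noteq> UNIV"
  shows "\<exists>v. schur_basis A I (u(m := v)) (Suc m)"
proof -
  let ?U = "span_upto u m"
  have inv: "\<forall>i\<in>I. \<forall>y\<in>?U. A i *v y \<in> ?U"
    using schur_basis_invariant[OF u] by blast
  obtain w where w: "w \<notin> ?U" "\<forall>i\<in>I. \<exists>\<mu>. A i *v w - \<mu> *s w \<in> ?U"
    using common_eigenvector_mod[OF comm vec.subspace_span inv vec.subspace_UNIV] not_full by blast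
  then obtain \<mu> where \<mu>: "\<And>i. i \<in> I \<Longrightarrow> A i *v w - \<mu> i *s w \<in> ?U"
    by metis
  obtain v a where v: "orthonormal_upto (u(m := v)) (Suc m)" and a: "a *s w - v \<in> ?U"
    using gram_schmidt_step u w(1) by (metis schur_basis_def)
  have "A i *v v - \<mu> i *s v \<in> ?U" if "i \<in> I" for i
  proof -
    have "A i *v v - \<mu> i *s v
        = a *s (A i *v w - \<mu> i *s w) - (A i *v (a *s w - v) - \<mu> i *s (a *s w - v))"
      by (simp add: vector_scalar_commute matrix_vector_mult_diff_distrib vector_ssub_ldistrib
          algebra_simps)
    also have "\<dots> \<in> ?U"
    proof (intro vec.span_diff)
      show "a *s (A i *v w - \<mu> i *s w) \<in> ?U"
        using \<mu>[OF that] by (rule vec.span_scale)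
      show "A i *v (a *s w - v) \<in> ?U"
        using inv a that by blast
      show "\<mu> i *s (a *s w - v) \<in> ?U"
        using a by (rule vec.span_scale)
    qed
    finally show ?thesis .
  qed
  then show ?thesis
    using schur_basis_Suc[OF u v] by blast
qed

lemma schur_basis_exists:
  fixes A :: "'i \<Rightarrow> complex^'n^'n"
  assumes comm: "\<forall>i\<in>I. \<forall>j\<in>I. A i ** A j = A j ** A i"
  shows "\<exists>(u :: nat \<Rightarrow> complex^'n) m. schur_basis A I u m \<and> span_upto u m = UNIV"
proof -
  let ?P = "\<lambda>m. \<exists>u :: nat \<Rightarrow> complex^'n. schur_basis A I u m"
  have "?P 0"
    by (simp add: schur_basis_def orthonormal_upto_def)
  moreover have "\<forall>m. ?P m \<longrightarrow> m \<le> CARD('n)"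
    unfolding schur_basis_def using orthonormal_upto_le_CARD by blast
  ultimately have "\<exists>m. ?P m \<and> (\<forall>k. ?P k \<longrightarrow> k \<le> m)"
    by (rule Nat.ex_has_greatest_nat)
  then obtain m where "?P m" and max: "\<forall>k. ?P k \<longrightarrow> k \<le> m"
    by blast
  then obtain u where u: "schur_basis A I u m" by blast
  have "span_upto u m = UNIV"
  proof (rule ccontr)
    assume "span_upto u m \<noteq> UNIV"
    with schur_basis_extend[OF comm u] have "Suc m \<le> m"
      using max by blast
    then show False by simp
  qed
  with u show ?thesis by blast
qed

lemma cinner_last_flag_shift:
  fixes M :: "complex^'n^'n"
  assumes u: "orthonormal_upto u (Suc m)"
    and inv: "\<And>y. y \<in> span_upto u m \<Longrightarrow> M *v y \<in> span_upto u m"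
    and last: "M *v u m - l *s u m \<in> span_upto u m"
    and z: "z \<in> span_upto u (Suc m)"
  shows "cinner (u m) (M *v z - \<mu> *s z) = (l - \<mu>) * cinner (u m) z"
proof -
  define c where "c = cinner (u m) z"
  define z0 where "z0 = z - c *s u m"
  have umum: "cinner (u m) (u m) = 1"
    using u by (simp add: orthonormal_upto_def)
  have "z0 \<in> span_upto u m"
  proof (rule span_upto_Suc_orthogonal[OF u])
    show "z0 \<in> span_upto u (Suc m)"
      unfolding z0_def using z in_span_upto_Suc by (intro vec.span_diff vec.span_scale)
    show "cinner (u m) z0 = 0"
      by (simp add: z0_def c_def cinner_diff_right cinner_scale_right umum)
  qed
  then have z0_part: "cinner (u m) (M *v z0 - \<mu> *s z0) = 0"
    using inv by (intro cinner_last_span_upto[OF u] vec.span_diff vec.span_scale) auto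
  have um_part: "cinner (u m) (M *v u m - \<mu> *s u m) = l - \<mu>"
  proof -
    have "M *v u m - \<mu> *s u m = (M *v u m - l *s u m) + (l - \<mu>) *s u m"
      by (simp add: vector_sub_rdistrib)
    then have "cinner (u m) (M *v u m - \<mu> *s u m)
        = cinner (u m) (M *v u m - l *s u m) + (l - \<mu>) * cinner (u m) (u m)"
      by (simp only: cinner_add_right cinner_scale_right)
    then show ?thesis
      using cinner_last_span_upto[OF u last] umum by simp
  qed
  have "M *v z - \<mu> *s z = (M *v z0 - \<mu> *s z0) + c *s (M *v u m - \<mu> *s u m)"
  proof -
    have "z = z0 + c *s u m"
      by (simp add: z0_def)
    then show ?thesis
      by (simp add: matrix_vector_right_distrib vector_scalar_commute vector_add_ldistrib
          vector_ssub_ldistrib vector_smult_assoc mult.commute)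
  qed
  then have "cinner (u m) (M *v z - \<mu> *s z)
      = cinner (u m) (M *v z0 - \<mu> *s z0) + c * cinner (u m) (M *v u m - \<mu> *s u m)"
    by (simp only: cinner_add_right cinner_scale_right)
  then show ?thesis
    using z0_part um_part by (simp add: c_def mult.commute)
qed

lemma shifted_commuting_apply:
  fixes M N :: "'a::field^'n^'n"
  assumes "M ** N = N ** M"
  shows "M *v (N *v w - b *s w) - a *s (N *v w - b *s w)
       = N *v (M *v w - a *s w) - b *s (M *v w - a *s w)"
proof -
  have "M *v (N *v w) = N *v (M *v w)"
    by (simp add: matrix_vector_mul_assoc assms)
  then show ?thesis
    by (simp add: matrix_vector_mult_diff_distrib vector_scalar_commute vector_ssub_ldistrib
        vector_smult_assoc mult.commute algebra_simps)
qed

lemma cinner_last_schur_basis_shift: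
  assumes u: "schur_basis A I u (Suc m)" and "i \<in> I" and z: "z \<in> span_upto u (Suc m)"
  shows "cinner (u m) (A i *v z - \<nu> *s z) = (cinner (u m) (A i *v u m) - \<nu>) * cinner (u m) z"
proof (rule cinner_last_flag_shift[OF _ _ _ z])
  show "orthonormal_upto u (Suc m)"
    using u by (simp add: schur_basis_def)
  show "A i *v y \<in> span_upto u m" if "y \<in> span_upto u m" for y
    by (rule schur_basis_invariant[OF u \<open>i \<in> I\<close> le_SucI[OF order_refl] that])
  show "A i *v u m - cinner (u m) (A i *v u m) *s u m \<in> span_upto u m"
    using u \<open>i \<in> I\<close> by (simp add: schur_basis_def)
qed

lemma cinner_last_eigen_mod_proportional:
  fixes A :: "'i \<Rightarrow> complex^'n^'n"
  assumes comm: "\<forall>i\<in>I. \<forall>j\<in>I. A i ** A j = A j ** A i"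
    and u: "schur_basis A I u (Suc m)" and ij: "i \<in> I" "j \<in> I"
    and w_eigen: "\<And>i. i \<in> I \<Longrightarrow> A i *v w - \<mu> i *s w \<in> span_upto u (Suc m)"
  shows "(cinner (u m) (A i *v u m) - \<mu> i) * cinner (u m) (A j *v w - \<mu> j *s w)
       = (cinner (u m) (A j *v u m) - \<mu> j) * cinner (u m) (A i *v w - \<mu> i *s w)"
proof -
  have "(cinner (u m) (A i *v u m) - \<mu> i) * cinner (u m) (A j *v w - \<mu> j *s w)
      = cinner (u m) (A i *v (A j *v w - \<mu> j *s w) - \<mu> i *s (A j *v w - \<mu> j *s w))"
    by (rule cinner_last_schur_basis_shift[OF u ij(1) w_eigen[OF ij(2)], symmetric])
  also have "\<dots> = cinner (u m) (A j *v (A i *v w - \<mu> i *s w) - \<mu> j *s (A i *v w - \<mu> i *s w))"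
    using comm ij by (simp only: shifted_commuting_apply)
  also have "\<dots> = (cinner (u m) (A j *v u m) - \<mu> j) * cinner (u m) (A i *v w - \<mu> i *s w)"
    by (rule cinner_last_schur_basis_shift[OF u ij(2) w_eigen[OF ij(1)]])
  finally show ?thesis .
qed

text \<open>
  Unless \<open>\<mu>\<close> is the last diagonal entry, subtracting a multiple of \<open>u m\<close> from \<open>w\<close> kills
  the \<open>u m\<close>-coordinate of every \<open>A i w - \<mu> i w\<close> at once: by the previous lemma these
  coordinates are proportional to the differences between \<open>\<mu> i\<close> and the diagonal entries.
\<close>

lemma eigenvector_mod_span_upto_descend:
  fixes A :: "'i \<Rightarrow> complex^'n^'n"
  assumes comm: "\<forall>i\<in>I. \<forall>j\<in>I. A i ** A j = A j ** A i"
    and u: "schur_basis A I u (Suc m)" and w: "w \<notin> span_upto u (Suc m)"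
    and w_eigen: "\<And>i. i \<in> I \<Longrightarrow> A i *v w - \<mu> i *s w \<in> span_upto u (Suc m)"
    and j: "j \<in> I" "\<mu> j \<noteq> cinner (u m) (A j *v u m)"
  shows "\<exists>w'. w' \<notin> span_upto u m \<and> (\<forall>i\<in>I. A i *v w' - \<mu> i *s w' \<in> span_upto u m)"
proof -
  have orth: "orthonormal_upto u (Suc m)"
    using u by (simp add: schur_basis_def)
  define l where "l i = cinner (u m) (A i *v u m)" for i
  define s where "s i = cinner (u m) (A i *v w - \<mu> i *s w)" for i
  define t where "t = s j / (l j - \<mu> j)"
  define w' where "w' = w - t *s u m"
  have "A i *v w' - \<mu> i *s w' \<in> span_upto u m" if "i \<in> I" for i
  proof (rule span_upto_Suc_orthogonal[OF orth])
    have eq: "A i *v w' - \<mu> i *s w' = (A i *v w - \<mu> i *s w) - t *s (A i *v u m - \<mu> i *s u m)"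
      by (simp add: w'_def matrix_vector_mult_diff_distrib vector_scalar_commute
          vector_ssub_ldistrib vector_smult_assoc mult.commute algebra_simps)
    have "A i *v u m \<in> span_upto u (Suc m)"
      by (rule schur_basis_invariant[OF u that order_refl in_span_upto_Suc])
    then show "A i *v w' - \<mu> i *s w' \<in> span_upto u (Suc m)"
      unfolding eq
      by (intro vec.span_diff[OF w_eigen[OF that]] vec.span_scale vec.span_diff
          vec.span_scale[OF in_span_upto_Suc])
    have "cinner (u m) (A i *v u m - \<mu> i *s u m) = l i - \<mu> i"
      using cinner_last_schur_basis_shift[OF u that in_span_upto_Suc] orth
      by (simp add: l_def orthonormal_upto_def)
    then have "cinner (u m) (A i *v w' - \<mu> i *s w') = s i - t * (l i - \<mu> i)"
      unfolding eq s_def by (simp only: cinner_diff_right cinner_scale_right)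
    also have "\<dots> = 0"
      using cinner_last_eigen_mod_proportional[OF comm u that j(1) w_eigen] j(2)
      by (simp add: t_def l_def s_def field_simps)
    finally show "cinner (u m) (A i *v w' - \<mu> i *s w') = 0" .
  qed
  moreover have "w' \<notin> span_upto u m"
  proof
    assume "w' \<in> span_upto u m"
    then have "w' + t *s u m \<in> span_upto u (Suc m)"
      using span_upto_mono[of m "Suc m" u] vec.span_scale[OF in_span_upto_Suc]
      by (auto intro!: vec.span_add)
    with w show False
      by (simp add: w'_def)
  qed
  ultimately show ?thesis by blast
qed

lemma joint_eigenvector_mod_schur_basis:
  fixes A :: "'i \<Rightarrow> complex^'n^'n"
  assumes comm: "\<forall>i\<in>I. \<forall>j\<in>I. A i ** A j = A j ** A i"
  shows "schur_basis A I u m \<Longrightarrow> w \<notin> span_upto u m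
    \<Longrightarrow> (\<And>i. i \<in> I \<Longrightarrow> A i *v w - \<mu> i *s w \<in> span_upto u m)
    \<Longrightarrow> \<exists>v. v \<noteq> 0 \<and> (\<forall>i\<in>I. A i *v v = \<mu> i *s v)"
proof (induction m arbitrary: w)
  case 0
  then have "w \<noteq> 0" "\<And>i. i \<in> I \<Longrightarrow> A i *v w = \<mu> i *s w"
    by simp_all
  then show ?case by blast
next
  case (Suc m)
  have u: "schur_basis A I u m"
    by (rule schur_basis_mono[OF Suc.prems(1)]) simp
  show ?case
  proof (cases "\<forall>i\<in>I. \<mu> i = cinner (u m) (A i *v u m)")
    case True
    have "u m \<notin> span_upto u m"
      using Suc.prems(1) by (intro last_notin_span_upto) (simp add: schur_basis_def)
    moreover have "A i *v u m - \<mu> i *s u m \<in> span_upto u m" if "i \<in> I" for i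
      using Suc.prems(1) True that by (simp add: schur_basis_def)
    ultimately show ?thesis
      by (rule Suc.IH[OF u])
  next
    case False
    then obtain j where "j \<in> I" "\<mu> j \<noteq> cinner (u m) (A j *v u m)"
      by blast
    from eigenvector_mod_span_upto_descend[OF comm Suc.prems this]
    obtain w' where w': "w' \<notin> span_upto u m" "\<forall>i\<in>I. A i *v w' - \<mu> i *s w' \<in> span_upto u m"
      by blast
    show ?thesis
      by (rule Suc.IH[OF u w'(1)]) (use w'(2) in blast)
  qed
qed

lemma schur_basis_joint_eigenvector:
  fixes A :: "'i \<Rightarrow> complex^'n^'n"
  assumes comm: "\<forall>i\<in>I. \<forall>j\<in>I. A i ** A j = A j ** A i"
    and u: "schur_basis A I u m" and "k < m"
  shows "\<exists>v. norm v = 1 \<and> (\<forall>i\<in>I. A i *v v = cinner (u k) (A i *v u k) *s v)"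
proof -
  have uk: "schur_basis A I u (Suc k)"
    by (rule schur_basis_mono[OF u]) (use \<open>k < m\<close> in simp)
  then have notin: "u k \<notin> span_upto u k"
    by (intro last_notin_span_upto) (simp add: schur_basis_def)
  have eigen_mod: "A i *v u k - cinner (u k) (A i *v u k) *s u k \<in> span_upto u k" if "i \<in> I" for i
    using uk that by (simp add: schur_basis_def)
  obtain v where "v \<noteq> 0" and v: "\<forall>i\<in>I. A i *v v = cinner (u k) (A i *v u k) *s v"
    using joint_eigenvector_mod_schur_basis[OF comm schur_basis_mono[OF uk le_SucI[OF order_refl]]
        notin eigen_mod] by blast
  define v' where "v' = of_real (inverse (norm v)) *s v"
  have "norm v' = 1"
    unfolding v'_def using \<open>v \<noteq> 0\<close> by (rule norm_normalize_vec)
  moreover have "\<forall>i\<in>I. A i *v v' = cinner (u k) (A i *v u k) *s v'"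
    using v by (simp add: v'_def vector_scalar_commute vector_smult_assoc mult.commute)
  ultimately show ?thesis by blast
qed

corollary schur_basis_joint_eigenvectors:
  fixes A :: "'i \<Rightarrow> complex^'n^'n"
  assumes comm: "\<forall>i\<in>I. \<forall>j\<in>I. A i ** A j = A j ** A i" and u: "schur_basis A I u m"
  shows "\<exists>v. \<forall>k\<in>{..<m}. norm (v k) = 1 \<and> (\<forall>i\<in>I. A i *v v k = cinner (u k) (A i *v u k) *s v k)"
proof -
  have "\<forall>k\<in>{..<m}. \<exists>w. norm w = 1 \<and> (\<forall>i\<in>I. A i *v w = cinner (u k) (A i *v u k) *s w)"
    using schur_basis_joint_eigenvector[OF comm u] by blast
  then show ?thesis
    by (rule bchoice)
qed

text \<open>The matrix \<open>\<Sum>k<m. d k (u k) (u k)\<^sup>*\<close>: it scales \<open>u k\<close> by \<open>d k\<close> and vanishes on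
  the orthogonal complement of the \<open>u k\<close>.\<close>

definition diag_in_basis :: "(nat \<Rightarrow> complex^'n) \<Rightarrow> nat \<Rightarrow> (nat \<Rightarrow> complex) \<Rightarrow> complex^'n^'n" where
  "diag_in_basis u m d = (\<chi> a b. \<Sum>k<m. d k * u k $ a * cnj (u k $ b))"

lemma diag_in_basis_mult_vec: "diag_in_basis u m d *v y = (\<Sum>k<m. (d k * cinner (u k) y) *s u k)"
proof -
  have "(diag_in_basis u m d *v y) $ a
      = (\<Sum>b\<in>UNIV. \<Sum>k<m. d k * u k $ a * (cnj (u k $ b) * y $ b))" for a
    by (simp add: diag_in_basis_def matrix_vector_mult_def sum_distrib_right sum_distrib_left
        mult_ac)
  also have "\<dots> a = (\<Sum>k<m. \<Sum>b\<in>UNIV. d k * u k $ a * (cnj (u k $ b) * y $ b))" for a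
    by (rule sum.swap)
  also have "\<dots> a = (\<Sum>k<m. (d k * cinner (u k) y) *s u k) $ a" for a
    by (simp add: cinner_def sum_distrib_left mult_ac)
  finally show ?thesis by (simp add: vec_eq_iff)
qed

lemma diag_in_basis_mult_vec_basis:
  assumes u: "orthonormal_upto u m" and "j < m"
  shows "diag_in_basis u m d *v u j = d j *s u j"
proof -
  have "diag_in_basis u m d *v u j = (\<Sum>k<m. if k = j then d j *s u j else 0)"
    unfolding diag_in_basis_mult_vec
    by (rule sum.cong) (use u \<open>j < m\<close> in \<open>auto simp: orthonormal_upto_def\<close>)
  with \<open>j < m\<close> show ?thesis by simp
qed

lemma diag_in_basis_mult:
  assumes u: "orthonormal_upto u m"
  shows "diag_in_basis u m d ** diag_in_basis u m e = diag_in_basis u m (\<lambda>k. d k * e k)"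
  unfolding matrix_eq
proof
  fix y
  have "(diag_in_basis u m d ** diag_in_basis u m e) *v y
      = (\<Sum>k<m. (d k * cinner (u k) (\<Sum>l<m. (e l * cinner (u l) y) *s u l)) *s u k)"
    by (simp add: diag_in_basis_mult_vec flip: matrix_vector_mul_assoc)
  also have "\<dots> = (\<Sum>k<m. (d k * e k * cinner (u k) y) *s u k)"
    by (rule sum.cong) (simp_all add: cinner_orthonormal_sum[OF u] mult.assoc)
  also have "\<dots> = diag_in_basis u m (\<lambda>k. d k * e k) *v y"
    by (simp add: diag_in_basis_mult_vec)
  finally show "(diag_in_basis u m d ** diag_in_basis u m e) *v y
      = diag_in_basis u m (\<lambda>k. d k * e k) *v y" .
qed

lemma adj_diag_in_basis: "adj (diag_in_basis u m d) = diag_in_basis u m (\<lambda>k. cnj (d k))"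
  by (simp add: adj_def diag_in_basis_def vec_eq_iff mult_ac)

lemma normal_diag_in_basis: "orthonormal_upto u m \<Longrightarrow> normal_matrix (diag_in_basis u m d)"
  unfolding normal_matrix_def adj_diag_in_basis by (simp add: diag_in_basis_mult mult.commute)

lemma diag_in_basis_commute:
  "orthonormal_upto u m \<Longrightarrow>
    diag_in_basis u m d ** diag_in_basis u m e = diag_in_basis u m e ** diag_in_basis u m d"
  by (simp add: diag_in_basis_mult mult.commute)

lemma hs_norm_sq_orthonormal_basis:
  assumes u: "orthonormal_upto u m" and full: "span_upto u m = UNIV"
  shows "(hs_norm X)\<^sup>2 = (\<Sum>k<m. (norm (X *v u k))\<^sup>2)"
proof -
  define r where "r j = (\<chi> l. cnj (X $ j $ l))" for j
  have row: "(X *v u k) $ j = cnj (cinner (u k) (r j))" for k j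
    by (simp add: r_def cinner_def matrix_vector_mult_def mult.commute)
  have "(\<Sum>k<m. (norm (X *v u k))\<^sup>2) = (\<Sum>j\<in>UNIV. \<Sum>k<m. (cmod (cinner (u k) (r j)))\<^sup>2)"
    by (simp add: norm_sq_vec row sum.swap[of _ "{..<m}"])
  also have "\<dots> = (\<Sum>j\<in>UNIV. (norm (r j))\<^sup>2)"
    using parseval_span_upto[OF u] full by simp
  also have "\<dots> = (hs_norm X)\<^sup>2"
    by (simp add: hs_norm_def norm_sq_vec r_def sum_nonneg)
  finally show ?thesis ..
qed

lemma norm_diff_proj_sq:
  assumes "cinner x x = 1"
  shows "(norm (y - cinner x y *s x))\<^sup>2 = (norm y)\<^sup>2 - (cmod (cinner x y))\<^sup>2"
proof -
  define c where "c = cinner x y"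
  have "of_real ((norm (y - c *s x))\<^sup>2) = cinner y y - cnj c * c"
    unfolding cinner_self[symmetric]
    by (simp add: cinner_diff_left cinner_diff_right cinner_scale_left cinner_scale_right assms
        cnj_cinner c_def algebra_simps)
  also have "\<dots> = of_real ((norm y)\<^sup>2 - (cmod c)\<^sup>2)"
    unfolding of_real_diff complex_norm_square cinner_self by (simp add: mult.commute)
  finally show ?thesis
    unfolding c_def of_real_eq_iff .
qed

definition qform :: "complex^'n \<Rightarrow> complex^'n^'n \<Rightarrow> real" where
  "qform x T = Re (cinner x (T *v x))"

lemma bounded_linear_qform: "bounded_linear (qform (x :: complex^'n))"
proof -
  have "(c *\<^sub>R T) *v x = of_real c *s (T *v x)" for c :: real and T :: "complex^'n^'n"
  proof -
    have "(c *\<^sub>R T) $ i $ j = of_real c * T $ i $ j" for i j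
      by (subst vector_scaleR_component)+ (rule scaleR_conv_of_real)
    then show ?thesis
      by (simp add: vec_eq_iff matrix_vector_mult_def sum_distrib_left mult.assoc)
  qed
  then have "linear (qform x)"
    by (intro linearI) (simp_all add: qform_def matrix_vector_mult_add_rdistrib cinner_add_right
        cinner_scale_right)
  then show ?thesis
    by (simp add: linear_conv_bounded_linear)
qed

lemma hs_norm_sq_diff_diag_in_basis:
  assumes u: "orthonormal_upto u m" and full: "span_upto u m = UNIV"
    and v: "\<And>k. k < m \<Longrightarrow> norm (v k) = 1 \<and> A *v v k = cinner (u k) (A *v u k) *s v k"
  shows "(hs_norm (A - diag_in_basis u m (\<lambda>k. cinner (u k) (A *v u k))))\<^sup>2
    = (\<Sum>k<m. qform (u k) (adj A ** A) - qform (v k) (adj A ** A))"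
proof -
  have "(norm ((A - diag_in_basis u m (\<lambda>k. cinner (u k) (A *v u k))) *v u k))\<^sup>2
      = qform (u k) (adj A ** A) - qform (v k) (adj A ** A)" if "k < m" for k
  proof -
    have "(norm ((A - diag_in_basis u m (\<lambda>k. cinner (u k) (A *v u k))) *v u k))\<^sup>2
        = (norm (A *v u k - cinner (u k) (A *v u k) *s u k))\<^sup>2"
      by (simp add: matrix_vector_mult_diff_rdistrib diag_in_basis_mult_vec_basis[OF u that])
    also have "\<dots> = (norm (A *v u k))\<^sup>2 - (norm (A *v v k))\<^sup>2"
      using u that v[OF that]
      by (simp add: norm_diff_proj_sq orthonormal_upto_def norm_smult_vec)
    finally show ?thesis
      by (simp add: qform_def norm_mult_vec_sq)
  qed
  then show ?thesis
    by (simp add: hs_norm_sq_orthonormal_basis[OF u full])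
qed

lemma num_range_bounded: "bounded (num_range T)"
proof -
  obtain K where K: "\<And>x. norm (T *v x) \<le> norm x * K"
    using bounded_linear.bounded[OF matrix_vector_mul_bounded_linear] by blast
  have "cmod z \<le> K" if "z \<in> num_range T" for z
  proof -
    obtain x where "norm x = 1" "z = cinner x (T *v x)"
      using \<open>z \<in> num_range T\<close> by (auto simp: num_range_def vnorm_eq_norm)
    then show ?thesis
      using cinner_Cauchy_Schwarz[of x "T *v x"] K[of x] by simp
  qed
  then show ?thesis
    by (auto simp: bounded_iff)
qed

lemma num_spread_eq_diameter: "num_spread T = diameter (num_range T)"
proof -
  have "(\<Sum>k\<in>UNIV. (cmod ((axis j 1 :: complex^'n) $ k))\<^sup>2) = (\<Sum>k\<in>UNIV. if k = j then 1 else 0)"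
    for j by (rule sum.cong) (simp_all add: axis_def)
  then have "vnorm (axis j 1 :: complex^'n) = 1" for j
    by (simp add: vnorm_def)
  then have "num_range T \<noteq> {}"
    by (auto simp: num_range_def)
  then show ?thesis
    by (simp add: num_spread_def diameter_def dist_norm case_prod_beta)
qed

lemma cmod_diff_le_num_spread:
  assumes "norm x = 1" "norm y = 1"
  shows "cmod (cinner x (T *v x) - cinner y (T *v y)) \<le> num_spread T"
proof -
  have "cinner x (T *v x) \<in> num_range T" "cinner y (T *v y) \<in> num_range T"
    using assms by (auto simp: num_range_def vnorm_eq_norm)
  then show ?thesis
    using diameter_bounded_bound[OF num_range_bounded]
    by (simp add: num_spread_eq_diameter dist_norm)
qed

lemma num_spread_nonneg: "0 \<le> num_spread T"
  by (simp add: num_spread_eq_diameter diameter_ge_0[OF num_range_bounded])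

lemma sum_qform_diff_le_num_spread:
  assumes "\<And>k. k < m \<Longrightarrow> norm (u k) = 1 \<and> norm (v k) = 1"
  shows "(\<Sum>k<m. qform (u k) T - qform (v k) T) \<le> real m * num_spread T"
proof -
  have "qform (u k) T - qform (v k) T \<le> num_spread T" if "k < m" for k
  proof -
    have "qform (u k) T - qform (v k) T = Re (cinner (u k) (T *v u k) - cinner (v k) (T *v v k))"
      by (simp add: qform_def)
    also have "\<dots> \<le> cmod (cinner (u k) (T *v u k) - cinner (v k) (T *v v k))"
      by (rule complex_Re_le_cmod)
    also have "\<dots> \<le> num_spread T"
      using assms[OF that] by (intro cmod_diff_le_num_spread) auto
    finally show ?thesis .
  qed
  then have "(\<Sum>k<m. qform (u k) T - qform (v k) T) \<le> (\<Sum>k<m. num_spread T)"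
    by (intro sum_mono) simp
  then show ?thesis by simp
qed

lemma has_sum_hs_norm_sq_diff_diag_in_basis:
  fixes A :: "'i \<Rightarrow> complex^'n^'n"
  assumes u: "orthonormal_upto u m" and full: "span_upto u m = UNIV"
    and v: "\<forall>k\<in>{..<m}. norm (v k) = 1 \<and> (\<forall>i\<in>I. A i *v v k = cinner (u k) (A i *v u k) *s v k)"
    and conv: "(\<lambda>i. adj (A i) ** A i) summable_on I"
  shows "((\<lambda>i. (hs_norm (A i - diag_in_basis u m (\<lambda>k. cinner (u k) (A i *v u k))))\<^sup>2) has_sum
      (\<Sum>k<m. qform (u k) (\<Sum>\<^sub>\<infinity>i\<in>I. adj (A i) ** A i) - qform (v k) (\<Sum>\<^sub>\<infinity>i\<in>I. adj (A i) ** A i))) I"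
proof -
  define L where "L T = (\<Sum>k<m. qform (u k) T - qform (v k) T)" for T
  have "bounded_linear L"
    unfolding L_def by (intro bounded_linear_sum bounded_linear_sub bounded_linear_qform)
  from has_sum_bounded_linear[OF this has_sum_infsum[OF conv]]
  have L_sum: "((\<lambda>i. L (adj (A i) ** A i)) has_sum L (\<Sum>\<^sub>\<infinity>i\<in>I. adj (A i) ** A i)) I" .
  have eq: "L (adj (A i) ** A i)
      = (hs_norm (A i - diag_in_basis u m (\<lambda>k. cinner (u k) (A i *v u k))))\<^sup>2" if "i \<in> I" for i
    unfolding L_def
    by (rule hs_norm_sq_diff_diag_in_basis[OF u full, symmetric]) (use v that in blast)
  from has_sum_cong[THEN iffD1, OF eq L_sum] show ?thesis
    by (simp only: L_def)
qed

theorem theorem1p2: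
  fixes A :: "'i \<Rightarrow> complex^'n^'n" and I :: "'i set"
  assumes comm: "\<forall>i\<in>I. \<forall>j\<in>I. A i ** A j = A j ** A i"
    and conv: "(\<lambda>i. adj (A i) ** A i) summable_on I"
  shows "\<exists>B :: 'i \<Rightarrow> complex^'n^'n.
           (\<forall>i\<in>I. normal_matrix (B i)) \<and>
           (\<forall>i\<in>I. \<forall>j\<in>I. B i ** B j = B j ** B i) \<and>
           (\<lambda>i. (hs_norm (A i - B i))\<^sup>2) summable_on I \<and>
           (\<Sum>\<^sub>\<infinity>i\<in>I. (hs_norm (A i - B i))\<^sup>2)
             \<le> real CARD('n) * num_spread (\<Sum>\<^sub>\<infinity>i\<in>I. adj (A i) ** A i)"
proof -
  obtain u m where schur: "schur_basis A I u m" and full: "span_upto u m = UNIV"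
    using schur_basis_exists[OF comm] by blast
  have u: "orthonormal_upto u m"
    using schur by (simp add: schur_basis_def)
  obtain v where v: "\<forall>k\<in>{..<m}. norm (v k) = 1 \<and>
      (\<forall>i\<in>I. A i *v v k = cinner (u k) (A i *v u k) *s v k)"
    using schur_basis_joint_eigenvectors[OF comm schur] by blast
  define B where "B i = diag_in_basis u m (\<lambda>k. cinner (u k) (A i *v u k))" for i
  define T where "T = (\<Sum>\<^sub>\<infinity>i\<in>I. adj (A i) ** A i)"
  have hs: "((\<lambda>i. (hs_norm (A i - B i))\<^sup>2) has_sum (\<Sum>k<m. qform (u k) T - qform (v k) T)) I"
    unfolding B_def T_def by (rule has_sum_hs_norm_sq_diff_diag_in_basis[OF u full v conv])
  have "(\<Sum>k<m. qform (u k) T - qform (v k) T) \<le> real m * num_spread T"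
    by (rule sum_qform_diff_le_num_spread) (use v norm_orthonormal_upto[OF u] in blast)
  also have "\<dots> \<le> real CARD('n) * num_spread T"
    using orthonormal_upto_le_CARD[OF u] num_spread_nonneg by (intro mult_right_mono) auto
  finally have "(\<Sum>\<^sub>\<infinity>i\<in>I. (hs_norm (A i - B i))\<^sup>2) \<le> real CARD('n) * num_spread T"
    by (simp add: infsumI[OF hs])
  moreover have "\<forall>i\<in>I. normal_matrix (B i)" "\<forall>i\<in>I. \<forall>j\<in>I. B i ** B j = B j ** B i"
    by (simp_all add: B_def normal_diag_in_basis[OF u] diag_in_basis_commute[OF u])
  ultimately show ?thesis
    using has_sum_imp_summable[OF hs] unfolding T_def by (intro exI[of _ B]) simp
qed

end
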